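(* Let $n\ge1$, $X=\{1,\ldots,n\}$, let $S$ be (the vertex set of) a permutograph on $S_n$, and let $F:S\to X$. The following are equivalent: (i) $F$ is a discrete piecewise linear function; (ii) $F$ satisfies the separation property; (iii) $F$ is a polynomial on $S$.
   Context: A permutation $\alpha$ of $X$ is written $\alpha=(x_1\cdots x_n)$ with $x_k=k\alpha$ (permutations act on the right and are composed left to right). It defines the linear order $<_\alpha$ on $X$: $x_i<_\alpha x_j\iff i<j$; $\le_\alpha,\ge_\alpha$ accordingly. The distance $d(\alpha,\beta)$ is the number of pairs $\{x,y\}\subseteq X$ appearing in reverse order in $\alpha$ and $\beta$. An ordered partition of $(X,<)$ is a partition $\pi=(X_1,\ldots,X_m)$ into nonempty sets with $x<y$ whenever $x\in X_i,y\in X_j,i<j$; it is trivial if it is $(\{1\},\ldots,\{n\})$. For nontrivial $\pi$, $\tau_\pi$ reverses the order of elements within each block. $\alpha,\beta$ are $\pi$-adjacent if $\alpha\beta^{-1}=\tau_\pi$ for a nontrivial ordered partition $\pi$, adjacent if $\pi$-adjacent for some $\pi$. The big permutograph $\Upsilon_n$ is the graph on $S_n$ with edges the adjacent pairs, edge $\alpha\beta$ weighted by $d(\alpha,\beta)$; a permutograph on $S_n$ is an isometric weighted subgraph of $\Upsilon_n$ (minimum path weight between any two of its vertices inside the subgraph equals that in $\Upsilon_n$, namely $d(\alpha,\beta)$). For $Y\subseteq X$, $Y\alpha=\{y\alpha:y\in Y\}$. $F$ is a discrete piecewise linear function if for any two $\pi$-adjacent $\alpha,\beta\in S$ with $\pi=(X_1,\ldots,X_m)$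 there is $i$ with $F(\alpha)\in X_i\alpha$ and $F(\beta)\in X_i\beta$. $F$ satisfies the separation property if for all $\alpha,\beta\in S$ there is $u\in X$ with $u\le_\alpha F(\alpha)$ and $u\ge_\beta F(\beta)$. With $G_k:S\to X$ the constant function $G_k(\alpha)=k$, $F$ is a polynomial on $S$ if there is a family $\{K_i\}_{i\in I}$ of subsets of $X$ ($I$ and each $K_i$ nonempty) such that $F(\alpha)=\bigvee_{i\in I}\bigwedge_{j\in K_i}G_j(\alpha)$ for all $\alpha\in S$, meets and joins taken with respect to $\le_\alpha$. *)

theory Defs
  imports
    "HOL-Combinatorics.Permutations"
    "HOL-Library.Disjoint_Sets"
    "HOL-Algebra.Lattice"
    "Graph_Theory.Graph_Theory"
begin

text \<open>
  The ground set is \<open>{1..n}\<close> and a permutation \<open>\<alpha>\<close> of it is a function with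
  \<open>\<alpha> permutes {1..n}\<close>. As permutations act on the right, \<open>k\<alpha>\<close> is \<open>\<alpha> k\<close>, so
  \<open>x\<^sub>k = \<alpha> k\<close>, the position of \<open>x\<close> in \<open>\<alpha>\<close> is \<open>inv \<alpha> x\<close>, and the left-to-right product
  \<open>\<alpha>\<beta>\<close> is \<open>\<beta> \<circ> \<alpha>\<close>.
\<close>

definition perm_less :: "(nat \<Rightarrow> nat) \<Rightarrow> nat \<Rightarrow> nat \<Rightarrow> bool" where
  "perm_less \<alpha> x y \<longleftrightarrow> inv \<alpha> x < inv \<alpha> y"

definition perm_le :: "(nat \<Rightarrow> nat) \<Rightarrow> nat \<Rightarrow> nat \<Rightarrow> bool" where
  "perm_le \<alpha> x y \<longleftrightarrow> inv \<alpha> x \<le> inv \<alpha> y"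

definition perm_order :: "nat \<Rightarrow> (nat \<Rightarrow> nat) \<Rightarrow> nat gorder" where
  "perm_order n \<alpha> = \<lparr>carrier = {1..n}, eq = (=), le = perm_le \<alpha>\<rparr>"

definition perm_dist :: "nat \<Rightarrow> (nat \<Rightarrow> nat) \<Rightarrow> (nat \<Rightarrow> nat) \<Rightarrow> nat" where
  "perm_dist n \<alpha> \<beta> =
     card {{x, y} | x y. x \<in> {1..n} \<and> y \<in> {1..n} \<and> perm_less \<alpha> x y \<and> perm_less \<beta> y x}"

definition ordered_partition :: "nat \<Rightarrow> nat set list \<Rightarrow> bool" where
  "ordered_partition n \<pi> \<longleftrightarrow>
     partition_on {1..n} (set \<pi>) \<and> sorted_wrt (\<lambda>A B. \<forall>x\<in>A. \<forall>y\<in>B. x < y) \<pi>"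

definition trivial_partition :: "nat \<Rightarrow> nat set list" where
  "trivial_partition n = map (\<lambda>k. {k}) [1..<Suc n]"

text \<open>
  The blocks of an ordered partition are intervals, so \<open>x \<mapsto> Min B + Max B - x\<close> reverses the
  block \<open>B\<close>; see \<open>block_reversal_permutes\<close>, \<open>block_reversal_image\<close> and
  \<open>block_reversal_reverses\<close> below.
\<close>

definition block_of :: "nat set list \<Rightarrow> nat \<Rightarrow> nat set" where
  "block_of \<pi> x = (THE B. B \<in> set \<pi> \<and> x \<in> B)"

definition block_reversal :: "nat set list \<Rightarrow> nat \<Rightarrow> nat" where
  "block_reversal \<pi> x =
     (if x \<in> \<Union> (set \<pi>) then Min (block_of \<pi> x) + Max (block_of \<pi> x) - x else x)"

definition partition_adjacent ::
    "nat \<Rightarrow> nat set list \<Rightarrow> (nat \<Rightarrow> nat) \<Rightarrow> (nat \<Rightarrow> nat) \<Rightarrow> bool" where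
  "partition_adjacent n \<pi> \<alpha> \<beta> \<longleftrightarrow>
     ordered_partition n \<pi> \<and> \<pi> \<noteq> trivial_partition n \<and> inv \<beta> \<circ> \<alpha> = block_reversal \<pi>"

definition perm_adjacent :: "nat \<Rightarrow> (nat \<Rightarrow> nat) \<Rightarrow> (nat \<Rightarrow> nat) \<Rightarrow> bool" where
  "perm_adjacent n \<alpha> \<beta> \<longleftrightarrow> (\<exists>\<pi>. partition_adjacent n \<pi> \<alpha> \<beta>)"

text \<open>
  Undirected graphs are symmetric loop-free digraphs (locale \<open>pair_graph\<close>), each edge being a
  pair of opposite arcs.
\<close>

definition big_permutograph :: "nat \<Rightarrow> (nat \<Rightarrow> nat) pair_pre_digraph" where
  "big_permutograph n =
     \<lparr>pverts = {\<alpha>. \<alpha> permutes {1..n}},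
      parcs = {(\<alpha>, \<beta>). \<alpha> permutes {1..n} \<and> \<beta> permutes {1..n} \<and> perm_adjacent n \<alpha> \<beta>}\<rparr>"

definition edge_weight :: "nat \<Rightarrow> ((nat \<Rightarrow> nat) \<times> (nat \<Rightarrow> nat)) weight_fun" where
  "edge_weight n e = real (perm_dist n (fst e) (snd e))"

text \<open>
  The function \<open>wf_digraph.\<mu>\<close> is the infimum of the weights of all walks between two vertices.
  The weights are natural numbers, so it is a minimum, and it is \<open>\<infinity>\<close> if there is no walk.
\<close>

definition permutograph :: "nat \<Rightarrow> (nat \<Rightarrow> nat) pair_pre_digraph \<Rightarrow> bool" where
  "permutograph n H \<longleftrightarrow>
     pair_graph H \<and>
     subgraph (with_proj H) (with_proj (big_permutograph n)) \<and>
     (\<forall>\<alpha>\<in>pverts H. \<forall>\<beta>\<in>pverts H.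
        wf_digraph.\<mu> (with_proj H) (edge_weight n) \<alpha> \<beta> =
        wf_digraph.\<mu> (with_proj (big_permutograph n)) (edge_weight n) \<alpha> \<beta>)"

definition discrete_piecewise_linear ::
    "nat \<Rightarrow> (nat \<Rightarrow> nat) set \<Rightarrow> ((nat \<Rightarrow> nat) \<Rightarrow> nat) \<Rightarrow> bool" where
  "discrete_piecewise_linear n S F \<longleftrightarrow>
     (\<forall>\<alpha>\<in>S. \<forall>\<beta>\<in>S. \<forall>\<pi>. partition_adjacent n \<pi> \<alpha> \<beta> \<longrightarrow>
        (\<exists>i<length \<pi>. F \<alpha> \<in> \<alpha> ` (\<pi> ! i) \<and> F \<beta> \<in> \<beta> ` (\<pi> ! i)))"

definition separation_property ::
    "nat \<Rightarrow> (nat \<Rightarrow> nat) set \<Rightarrow> ((nat \<Rightarrow> nat) \<Rightarrow> nat) \<Rightarrow> bool" where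
  "separation_property n S F \<longleftrightarrow>
     (\<forall>\<alpha>\<in>S. \<forall>\<beta>\<in>S. \<exists>u\<in>{1..n}. perm_le \<alpha> u (F \<alpha>) \<and> perm_le \<beta> (F \<beta>) u)"

definition const_fn :: "nat \<Rightarrow> (nat \<Rightarrow> nat) \<Rightarrow> nat" where
  "const_fn k \<alpha> = k"

text \<open>
  The family of subsets is given as the set of its members; by idempotence of the join,
  repeated members are irrelevant.
\<close>

definition polynomial_on ::
    "nat \<Rightarrow> (nat \<Rightarrow> nat) set \<Rightarrow> ((nat \<Rightarrow> nat) \<Rightarrow> nat) \<Rightarrow> bool" where
  "polynomial_on n S F \<longleftrightarrow>
     (\<exists>\<K>. \<K> \<noteq> {} \<and> (\<forall>K\<in>\<K>. K \<noteq> {} \<and> K \<subseteq> {1..n}) \<and>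
        (\<forall>\<alpha>\<in>S. F \<alpha> =
           (SSUP\<^bsub>perm_order n \<alpha>\<^esub> K:\<K>. IINF\<^bsub>perm_order n \<alpha>\<^esub> j:K. const_fn j \<alpha>)))"

lemma block_of_eq:
  assumes "ordered_partition n \<pi>" "B \<in> set \<pi>" "x \<in> B"
  shows "block_of \<pi> x = B"
  unfolding block_of_def
proof (rule the_equality)
  show "C = B" if "C \<in> set \<pi> \<and> x \<in> C" for C
    using assms that by (auto simp: ordered_partition_def partition_on_def disjoint_def)
qed (use assms in auto)

lemma block_interval:
  assumes op: "ordered_partition n \<pi>" and B: "B \<in> set \<pi>"
  shows "finite B" "B \<noteq> {}" "z \<in> B \<longleftrightarrow> Min B \<le> z \<and> z \<le> Max B"
proof -
  have un: "\<Union> (set \<pi>) = {1..n}" and ne: "{} \<notin> set \<pi>"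
    using op unfolding ordered_partition_def partition_on_def by blast+
  have sub: "B \<subseteq> {1..n}" unfolding un[symmetric] using B by (rule Union_upper)
  then show fin: "finite B" by (rule finite_subset) simp
  show nonempty: "B \<noteq> {}" using ne B by metis
  have "z \<in> B" if z: "Min B \<le> z" "z \<le> Max B" for z
  proof -
    have m: "Min B \<in> B" "Max B \<in> B" using fin nonempty by simp_all
    then have "Min B \<in> {1..n}" "Max B \<in> {1..n}" by (simp_all only: subsetD[OF sub])
    then have "z \<in> \<Union> (set \<pi>)" unfolding un using z by simp
    then obtain C where C: "C \<in> set \<pi>" "z \<in> C" by (rule UnionE)
    obtain i j where i: "i < length \<pi>" "\<pi> ! i = B" and j: "j < length \<pi>" "\<pi> ! j = C"
      using B C(1) unfolding in_set_conv_nth by blast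
    have s: "\<forall>x\<in>\<pi> ! k. \<forall>y\<in>\<pi> ! l. x < y" if "k < l" "l < length \<pi>" for k l
      using op that unfolding ordered_partition_def sorted_wrt_iff_nth_less by blast
    consider "i < j" | "j < i" | "i = j" by linarith
    then show ?thesis
    proof cases
      case 1
      have "Max B < z" using s[OF 1 j(1)] m(2) C(2) unfolding i(2) j(2) by blast
      then show ?thesis using z by simp
    next
      case 2
      have "z < Min B" using s[OF 2 i(1)] m(1) C(2) unfolding i(2) j(2) by blast
      then show ?thesis using z by simp
    next
      case 3
      then show ?thesis using i(2) j(2) C(2) by metis
    qed
  qed
  then show "z \<in> B \<longleftrightarrow> Min B \<le> z \<and> z \<le> Max B" using fin Min_le Max_ge by blast
qed

lemma block_reversal_eq:
  assumes "ordered_partition n \<pi>" "B \<in> set \<pi>" "x \<in> B"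
  shows "block_reversal \<pi> x = Min B + Max B - x"
  using assms block_of_eq[OF assms] by (auto simp: block_reversal_def)

lemma block_reversal_in:
  assumes "ordered_partition n \<pi>" "B \<in> set \<pi>" "x \<in> B"
  shows "block_reversal \<pi> x \<in> B"
proof -
  have "Min B \<le> x" "x \<le> Max B" using block_interval(3)[OF assms(1,2)] assms(3) by auto
  then have "Min B + Max B - x \<in> B" unfolding block_interval(3)[OF assms(1,2)] by linarith
  then show ?thesis using block_reversal_eq[OF assms] by simp
qed

lemma block_reversal_involution:
  assumes "ordered_partition n \<pi>"
  shows "block_reversal \<pi> (block_reversal \<pi> x) = x"
proof (cases "x \<in> \<Union> (set \<pi>)")
  case True
  then obtain B where B: "B \<in> set \<pi>" "x \<in> B" by auto
  have "x \<le> Max B" using block_interval(3)[OF assms B(1)] B(2) by auto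
  then show ?thesis
    using block_reversal_eq[OF assms B] block_reversal_eq[OF assms B(1) block_reversal_in[OF assms B]]
    by simp
qed (simp add: block_reversal_def)

lemma block_reversal_permutes:
  assumes "ordered_partition n \<pi>"
  shows "block_reversal \<pi> permutes {1..n}"
  unfolding permutes_def
proof (intro conjI allI impI)
  show "block_reversal \<pi> x = x" if "x \<notin> {1..n}" for x
  proof -
    have "x \<notin> \<Union> (set \<pi>)"
      using that assms by (simp only: ordered_partition_def partition_on_def) blast
    then show ?thesis by (simp add: block_reversal_def)
  qed
  show "\<exists>!x. block_reversal \<pi> x = y" for y
    using block_reversal_involution[OF assms] by (intro ex1I[of _ "block_reversal \<pi> y"]) auto
qed

lemma block_reversal_image:
  assumes "ordered_partition n \<pi>" "B \<in> set \<pi>"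
  shows "block_reversal \<pi> ` B = B"
proof
  show "block_reversal \<pi> ` B \<subseteq> B" using block_reversal_in[OF assms] by auto
  show "B \<subseteq> block_reversal \<pi> ` B"
  proof
    fix x assume "x \<in> B"
    then show "x \<in> block_reversal \<pi> ` B"
      using block_reversal_in[OF assms] block_reversal_involution[OF assms(1)]
      by (intro image_eqI[of _ _ "block_reversal \<pi> x"]) simp_all
  qed
qed

lemma block_reversal_reverses:
  assumes "ordered_partition n \<pi>" "B \<in> set \<pi>" "x \<in> B" "y \<in> B" "x < y"
  shows "block_reversal \<pi> y < block_reversal \<pi> x"
proof -
  have "y \<le> Max B" using block_interval(3)[OF assms(1,2)] assms(4) by auto
  then show ?thesis
    using assms(5) block_reversal_eq[OF assms(1-3)] block_reversal_eq[OF assms(1,2,4)] by simp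
qed

end

theory Submission
  imports Defs
begin

text \<open>
  The separation property is the pivot. Moving from \<open>\<alpha>\<close> to an adjacent \<open>\<beta>\<close> leaves every element in
  its block and reverses the order within blocks. Hence separation of \<open>(\<alpha>, \<beta>)\<close> and of \<open>(\<beta>, \<alpha>)\<close>
  compares the blocks of \<open>F \<alpha>\<close> and \<open>F \<beta>\<close> in both directions. Conversely, isometry provides a walk
  from \<open>\<alpha>\<close> to \<open>\<beta>\<close> of weight \<open>d(\<alpha>, \<beta>)\<close>, along which no pair is inverted twice; so a separating
  element can be carried back along it, and is replaced by \<open>F\<close> of the current vertex whenever an
  edge moves it past that value. For polynomials only the linear orders matter: separation makes the
  sets \<open>K\<^sub>\<beta> = {u. F \<beta> \<le>\<^sub>\<beta> u}\<close> a presentation of \<open>F\<close>, and conversely the \<open>\<alpha>\<close>-minimum of a set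
  attaining the join at \<open>\<beta>\<close> is a separating element.
\<close>

section \<open>Inversions\<close>

definition inversions ::
    "'a set \<Rightarrow> ('a \<Rightarrow> 'b :: linorder) \<Rightarrow> ('a \<Rightarrow> 'c :: linorder) \<Rightarrow> ('a \<times> 'a) set" where
  "inversions A f g = {(x, y) \<in> A \<times> A. f x < f y \<and> g y < g x}"

lemma inversions_self [simp]: "inversions A f f = {}"
  by (auto simp: inversions_def)

lemma finite_inversions [simp]: "finite A \<Longrightarrow> finite (inversions A f g)"
  by (rule finite_subset[of _ "A \<times> A"]) (auto simp: inversions_def)

lemma inversions_disjoint: "inversions A f g \<inter> inversions A g h = {}"
  by (auto simp: inversions_def)

lemma inversions_subset_Un:
  assumes "inj_on g A"
  shows "inversions A f h \<subseteq> inversions A f g \<union> inversions A g h"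
proof clarify
  fix x y assume xy: "(x, y) \<in> inversions A f h" "(x, y) \<notin> inversions A g h"
  then have "x \<in> A" "y \<in> A" "x \<noteq> y"
    by (auto simp: inversions_def)
  then have "g x \<noteq> g y"
    using assms by (simp add: inj_on_eq_iff)
  then show "(x, y) \<in> inversions A f g"
    using xy by (auto simp: inversions_def)
qed

lemma card_inversions_Un:
  assumes "finite A"
  shows "card (inversions A f g \<union> inversions A g h) =
    card (inversions A f g) + card (inversions A g h)"
  using assms by (intro card_Un_disjoint) (simp_all add: inversions_disjoint)

lemma card_inversions_triangle:
  assumes "finite A" "inj_on g A"
  shows "card (inversions A f h) \<le> card (inversions A f g) + card (inversions A g h)"
  using card_mono[OF _ inversions_subset_Un[OF assms(2), of f h]] assms(1)
  by (simp add: card_inversions_Un)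

lemma inversions_eq_Un_if_card_add:
  assumes "finite A" "inj_on g A"
    and "card (inversions A f g) + card (inversions A g h) = card (inversions A f h)"
  shows "inversions A f h = inversions A f g \<union> inversions A g h"
  using assms by (intro card_subset_eq inversions_subset_Un) (simp_all add: card_inversions_Un)

lemma transpose_Suc_less_iff:
  "transpose k (Suc k) i < transpose k (Suc k) j \<longleftrightarrow>
    i = Suc k \<and> j = k \<or> i < j \<and> \<not> (i = k \<and> j = Suc k)"
  unfolding transpose_def
  by (cases "i = k"; cases "i = Suc k"; cases "j = k"; cases "j = Suc k") auto

lemma inversions_transpose_Suc:
  "inversions A f (transpose k (Suc k) \<circ> f) = {(x, y) \<in> A \<times> A. f x = k \<and> f y = Suc k}"
  by (auto simp: inversions_def transpose_Suc_less_iff)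

lemma inversions_transpose_Suc_left:
  assumes "\<And>x y. x \<in> A \<Longrightarrow> y \<in> A \<Longrightarrow> f x = k \<Longrightarrow> f y = Suc k \<Longrightarrow> g y < g x"
  shows "inversions A (transpose k (Suc k) \<circ> f) g = inversions A f g -
    {(x, y). f x = k \<and> f y = Suc k}"
proof -
  have "(x, y) \<in> inversions A (transpose k (Suc k) \<circ> f) g \<longleftrightarrow>
      (x, y) \<in> inversions A f g \<and> \<not> (f x = k \<and> f y = Suc k)" for x y
    using assms[of y x] by (simp add: inversions_def transpose_Suc_less_iff) (metis less_asym)
  then show ?thesis
    by auto
qed

section \<open>The distance of permutations\<close>

lemma perm_dist_eq_card_inversions:
  "perm_dist n \<alpha> \<beta> = card (inversions {1..n} (inv \<alpha>) (inv \<beta>))"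
proof -
  have "inj_on (\<lambda>(x, y). {x, y}) (inversions {1..n} (inv \<alpha>) (inv \<beta>))"
    by (auto simp: inj_on_def inversions_def doubleton_eq_iff)
  moreover have "{{x, y} | x y. x \<in> {1..n} \<and> y \<in> {1..n} \<and> perm_less \<alpha> x y \<and> perm_less \<beta> y x} =
      (\<lambda>(x, y). {x, y}) ` inversions {1..n} (inv \<alpha>) (inv \<beta>)"
    unfolding inversions_def perm_less_def by auto
  ultimately show ?thesis
    unfolding perm_dist_def by (simp add: card_image)
qed

lemma perm_dist_self [simp]: "perm_dist n \<alpha> \<alpha> = 0"
  by (simp add: perm_dist_eq_card_inversions)

lemma perm_dist_triangle:
  assumes "\<beta> permutes {1..n}"
  shows "perm_dist n \<alpha> \<gamma> \<le> perm_dist n \<alpha> \<beta> + perm_dist n \<beta> \<gamma>"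
  unfolding perm_dist_eq_card_inversions
  by (intro card_inversions_triangle permutes_inj_on[OF permutes_inv[OF assms]]) simp

lemma inversion_preserved_on_geodesic:
  assumes "\<beta> permutes {1..n}"
    and "perm_dist n \<alpha> \<beta> + perm_dist n \<beta> \<gamma> = perm_dist n \<alpha> \<gamma>"
    and "x \<in> {1..n}" "y \<in> {1..n}" "perm_less \<alpha> x y" "perm_less \<beta> y x"
  shows "perm_less \<gamma> y x"
proof -
  have "inversions {1..n} (inv \<alpha>) (inv \<gamma>) =
      inversions {1..n} (inv \<alpha>) (inv \<beta>) \<union> inversions {1..n} (inv \<beta>) (inv \<gamma>)"
    using assms(2) unfolding perm_dist_eq_card_inversions
    by (intro inversions_eq_Un_if_card_add permutes_inj_on[OF permutes_inv[OF assms(1)]]) simp_all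
  moreover have "(x, y) \<in> inversions {1..n} (inv \<alpha>) (inv \<beta>)"
    using assms(3-6) by (simp add: inversions_def perm_less_def)
  ultimately have "(x, y) \<in> inversions {1..n} (inv \<alpha>) (inv \<gamma>)"
    by blast
  then show ?thesis
    by (simp add: inversions_def perm_less_def)
qed

lemma inv_comp_transpose:
  assumes "\<alpha> permutes A"
  shows "inv (\<alpha> \<circ> transpose i j) = transpose i j \<circ> inv \<alpha>"
  using assms by (simp add: o_inv_distrib permutes_bij)

lemma perm_dist_comp_transpose_Suc:
  assumes "\<alpha> permutes {1..n}" "k \<in> {1..<n}"
  shows "perm_dist n \<alpha> (\<alpha> \<circ> transpose k (Suc k)) = 1"
proof -
  have "\<alpha> k \<in> {1..n}" "\<alpha> (Suc k) \<in> {1..n}"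
    using assms(2) permutes_in_image[OF assms(1)] by simp_all
  then have "inversions {1..n} (inv \<alpha>) (transpose k (Suc k) \<circ> inv \<alpha>) = {(\<alpha> k, \<alpha> (Suc k))}"
    by (auto simp: inversions_transpose_Suc permutes_inv_eq[OF assms(1)])
  then show ?thesis
    by (simp add: perm_dist_eq_card_inversions inv_comp_transpose[OF assms(1)])
qed

lemma perm_dist_comp_transpose_Suc_left:
  assumes "\<alpha> permutes {1..n}" "k \<in> {1..<n}" "perm_less \<beta> (\<alpha> (Suc k)) (\<alpha> k)"
  shows "perm_dist n \<alpha> \<beta> = Suc (perm_dist n (\<alpha> \<circ> transpose k (Suc k)) \<beta>)"
proof -
  have "\<alpha> k \<in> {1..n}" "\<alpha> (Suc k) \<in> {1..n}"
    using assms(2) permutes_in_image[OF assms(1)] by simp_all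
  then have mem: "(\<alpha> k, \<alpha> (Suc k)) \<in> inversions {1..n} (inv \<alpha>) (inv \<beta>)"
    using assms(3) by (simp add: inversions_def perm_less_def permutes_inverses[OF assms(1)])
  have "inversions {1..n} (transpose k (Suc k) \<circ> inv \<alpha>) (inv \<beta>) =
      inversions {1..n} (inv \<alpha>) (inv \<beta>) - {(x, y). inv \<alpha> x = k \<and> inv \<alpha> y = Suc k}"
    using assms(3) by (intro inversions_transpose_Suc_left)
      (auto simp: perm_less_def permutes_inv_eq[OF assms(1)])
  also have "{(x, y). inv \<alpha> x = k \<and> inv \<alpha> y = Suc k} = {(\<alpha> k, \<alpha> (Suc k))}"
    by (auto simp: permutes_inv_eq[OF assms(1)])
  finally have removed: "inversions {1..n} (transpose k (Suc k) \<circ> inv \<alpha>) (inv \<beta>) =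
      inversions {1..n} (inv \<alpha>) (inv \<beta>) - {(\<alpha> k, \<alpha> (Suc k))}" .
  show ?thesis
    unfolding perm_dist_eq_card_inversions inv_comp_transpose[OF assms(1)] removed
    by (rule card_Suc_Diff1[symmetric, OF finite_inversions mem]) simp
qed

lemma permutes_descent_exists:
  assumes permutes: "f permutes {1..n}" and "f \<noteq> id"
  shows "\<exists>k\<in>{1..<n}. f (Suc k) < f k"
proof (rule ccontr)
  assume "\<not> ?thesis"
  then have ascent: "f k < f (Suc k)" if "k \<in> {1..<n}" for k
    using that inj_eq[OF permutes_inj[OF permutes], of k "Suc k"] by force
  have range: "f k \<in> {1..n} \<longleftrightarrow> k \<in> {1..n}" for k
    by (rule permutes_in_image[OF permutes])
  have "f k < f (Suc k)" for k
  proof (cases "k \<in> {1..<n}")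
    case False
    then have "f k \<le> k"
      using range[of k] permutes_not_in[OF permutes, of k] by (cases "k \<in> {1..n}") auto
    moreover have "Suc k \<le> f (Suc k)"
      using False range[of "Suc k"] permutes_not_in[OF permutes, of "Suc k"]
      by (cases "Suc k \<in> {1..n}") auto
    ultimately show ?thesis
      by simp
  qed (rule ascent)
  then have "k \<le> f k" for k
    by (simp add: strict_mono_Suc_iff strict_mono_imp_increasing)
  then show False
    using permutes_natset_ge[OF permutes] \<open>f \<noteq> id\<close> by blast
qed

lemma consecutive_inversion_exists:
  assumes "\<alpha> permutes {1..n}" "\<beta> permutes {1..n}" "\<alpha> \<noteq> \<beta>"
  shows "\<exists>k\<in>{1..<n}. perm_less \<beta> (\<alpha> (Suc k)) (\<alpha> k)"
proof -
  have "\<beta> \<circ> (inv \<beta> \<circ> \<alpha>) = \<alpha>"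
    by (simp add: o_assoc permutes_inv_o(1)[OF assms(2)])
  then have "inv \<beta> \<circ> \<alpha> \<noteq> id"
    using assms(3) by force
  then show ?thesis
    using permutes_descent_exists[OF permutes_compose[OF assms(1) permutes_inv[OF assms(2)]]]
    by (auto simp: perm_less_def)
qed

section \<open>Blocks of ordered partitions\<close>

definition block_index :: "nat set list \<Rightarrow> nat \<Rightarrow> nat" where
  "block_index \<pi> x = (THE i. i < length \<pi> \<and> x \<in> \<pi> ! i)"

lemma ordered_partition_nth_less:
  assumes "ordered_partition n \<pi>" "i < j" "j < length \<pi>" "x \<in> \<pi> ! i" "y \<in> \<pi> ! j"
  shows "x < y"
  using assms unfolding ordered_partition_def sorted_wrt_iff_nth_less by blast

lemma block_index_eqI:
  assumes "ordered_partition n \<pi>" "i < length \<pi>" "x \<in> \<pi> ! i"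
  shows "block_index \<pi> x = i"
  unfolding block_index_def
proof (rule the_equality)
  show "j = i" if "j < length \<pi> \<and> x \<in> \<pi> ! j" for j
    using ordered_partition_nth_less[OF assms(1), of _ _ x x] assms(2,3) that
    by (metis less_irrefl nat_neq_iff)
qed (use assms in blast)

lemma block_index_in:
  assumes "ordered_partition n \<pi>" "x \<in> {1..n}"
  shows "block_index \<pi> x < length \<pi>" "x \<in> \<pi> ! block_index \<pi> x"
proof -
  have "x \<in> \<Union> (set \<pi>)"
    using assms by (simp only: ordered_partition_def partition_on_def)
  then obtain i where "i < length \<pi>" "x \<in> \<pi> ! i"
    by (auto simp: in_set_conv_nth)
  with block_index_eqI[OF assms(1) this]
  show "block_index \<pi> x < length \<pi>" "x \<in> \<pi> ! block_index \<pi> x"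
    by simp_all
qed

lemma block_index_mono:
  assumes "ordered_partition n \<pi>" "x \<in> {1..n}" "y \<in> {1..n}" "x \<le> y"
  shows "block_index \<pi> x \<le> block_index \<pi> y"
  using ordered_partition_nth_less[OF assms(1) _ block_index_in(1)[OF assms(1,2)]
      block_index_in(2)[OF assms(1,3)] block_index_in(2)[OF assms(1,2)]] assms(4)
  by (meson leD leI)

lemma block_index_block_reversal:
  assumes "ordered_partition n \<pi>" "x \<in> {1..n}"
  shows "block_index \<pi> (block_reversal \<pi> x) = block_index \<pi> x"
  using block_index_in[OF assms]
  by (intro block_index_eqI[OF assms(1)] block_reversal_in[OF assms(1)]) simp_all

lemma block_reversal_less:
  assumes "ordered_partition n \<pi>" "x \<in> {1..n}" "y \<in> {1..n}"
    and "block_index \<pi> x = block_index \<pi> y" "x < y"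
  shows "block_reversal \<pi> y < block_reversal \<pi> x"
  using block_index_in[OF assms(1,2)] block_index_in[OF assms(1,3)] assms(4,5)
  by (intro block_reversal_reverses[OF assms(1), of "\<pi> ! block_index \<pi> x"]) simp_all

section \<open>Adjacent permutations\<close>

definition separated :: "nat \<Rightarrow> (nat \<Rightarrow> nat) \<Rightarrow> nat \<Rightarrow> (nat \<Rightarrow> nat) \<Rightarrow> nat \<Rightarrow> bool" where
  "separated n \<alpha> x \<beta> y \<longleftrightarrow> (\<exists>u\<in>{1..n}. perm_le \<alpha> u x \<and> perm_le \<beta> y u)"

lemma separation_property_iff_separated:
  "separation_property n S F \<longleftrightarrow> (\<forall>\<alpha>\<in>S. \<forall>\<beta>\<in>S. separated n \<alpha> (F \<alpha>) \<beta> (F \<beta>))"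
  by (simp add: separation_property_def separated_def)

lemma in_image_permutes_iff:
  assumes "\<alpha> permutes A"
  shows "x \<in> \<alpha> ` B \<longleftrightarrow> inv \<alpha> x \<in> B"
  using permutes_inv_eq[OF assms] by (metis image_iff)

locale adjacent_permutations =
  fixes n :: nat and \<pi> :: "nat set list" and \<alpha> \<beta> :: "nat \<Rightarrow> nat"
  assumes adjacent: "partition_adjacent n \<pi> \<alpha> \<beta>"
    and permutes_left: "\<alpha> permutes {1..n}"
    and permutes_right: "\<beta> permutes {1..n}"
begin

lemma ordered: "ordered_partition n \<pi>"
  using adjacent by (simp add: partition_adjacent_def)

lemma adjacent_permutations_sym: "adjacent_permutations n \<pi> \<beta> \<alpha>"
proof
  have "inv \<alpha> \<circ> \<beta> = inv (block_reversal \<pi>)"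
    using adjacent o_inv_distrib[OF bij_imp_bij_inv permutes_bij[OF permutes_left], of \<beta>]
    by (simp add: partition_adjacent_def permutes_bij[OF permutes_right] inv_inv_eq)
  also have "\<dots> = block_reversal \<pi>"
    using block_reversal_involution[OF ordered] by (intro inv_unique_comp) auto
  finally show "partition_adjacent n \<pi> \<beta> \<alpha>"
    using adjacent by (simp add: partition_adjacent_def)
qed (fact permutes_right permutes_left)+

lemma position_in:
  assumes "x \<in> {1..n}"
  shows "inv \<alpha> x \<in> {1..n}" "inv \<beta> x \<in> {1..n}"
  using assms permutes_in_image[OF permutes_inv[OF permutes_left]]
    permutes_in_image[OF permutes_inv[OF permutes_right]] by blast+

lemma inv_right_eq_block_reversal: "inv \<beta> x = block_reversal \<pi> (inv \<alpha> x)"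
proof -
  have "inv \<beta> \<circ> \<alpha> = block_reversal \<pi>"
    using adjacent by (simp add: partition_adjacent_def)
  then show ?thesis
    using permutes_inverses(1)[OF permutes_left] by (metis comp_apply)
qed

lemma block_index_inv_right:
  assumes "x \<in> {1..n}"
  shows "block_index \<pi> (inv \<beta> x) = block_index \<pi> (inv \<alpha> x)"
  by (simp only: inv_right_eq_block_reversal
      block_index_block_reversal[OF ordered position_in(1)[OF assms]])

lemma common_block_iff:
  assumes "x \<in> {1..n}" "y \<in> {1..n}"
  shows "(\<exists>i<length \<pi>. x \<in> \<alpha> ` (\<pi> ! i) \<and> y \<in> \<beta> ` (\<pi> ! i)) \<longleftrightarrow>
    block_index \<pi> (inv \<alpha> x) = block_index \<pi> (inv \<beta> y)"
  unfolding in_image_permutes_iff[OF permutes_left] in_image_permutes_iff[OF permutes_right]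
  using block_index_eqI[OF ordered] block_index_in[OF ordered position_in(1)[OF assms(1)]]
    block_index_in[OF ordered position_in(2)[OF assms(2)]] by metis

lemma perm_less_reversed_within_block:
  assumes "x \<in> {1..n}" "y \<in> {1..n}" "block_index \<pi> (inv \<alpha> x) = block_index \<pi> (inv \<alpha> y)"
    and "perm_less \<alpha> x y"
  shows "perm_less \<beta> y x"
  using assms(4) block_reversal_less[OF ordered position_in(1)[OF assms(1)] position_in(1)[OF assms(2)]
      assms(3)]
  by (simp add: perm_less_def inv_right_eq_block_reversal)

lemma separated_imp_block_index_le:
  assumes "x \<in> {1..n}" "y \<in> {1..n}" "separated n \<alpha> x \<beta> y"
  shows "block_index \<pi> (inv \<beta> y) \<le> block_index \<pi> (inv \<alpha> x)"
proof -
  obtain u where separator: "u \<in> {1..n}" "inv \<alpha> u \<le> inv \<alpha> x" "inv \<beta> y \<le> inv \<beta> u"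
    using assms(3) by (auto simp: separated_def perm_le_def)
  have "block_index \<pi> (inv \<beta> y) \<le> block_index \<pi> (inv \<beta> u)"
    by (intro block_index_mono[OF ordered] position_in assms separator)
  also have "\<dots> = block_index \<pi> (inv \<alpha> u)"
    by (rule block_index_inv_right[OF separator(1)])
  also have "\<dots> \<le> block_index \<pi> (inv \<alpha> x)"
    by (intro block_index_mono[OF ordered] position_in assms separator)
  finally show ?thesis .
qed

lemma block_index_eq_if_separated:
  assumes "x \<in> {1..n}" "y \<in> {1..n}" "separated n \<alpha> x \<beta> y" "separated n \<beta> y \<alpha> x"
  shows "block_index \<pi> (inv \<alpha> x) = block_index \<pi> (inv \<beta> y)"
  using separated_imp_block_index_le[OF assms(1,2,3)]
    adjacent_permutations.separated_imp_block_index_le[OF adjacent_permutations_sym assms(2,1,4)]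
  by simp

lemma perm_less_reversed_if_le_right:
  assumes "x \<in> {1..n}" "y \<in> {1..n}" "u \<in> {1..n}"
    and "block_index \<pi> (inv \<alpha> x) = block_index \<pi> (inv \<beta> y)"
    and "perm_le \<beta> u y" "perm_less \<alpha> x u"
  shows "perm_less \<beta> u x"
proof -
  have "block_index \<pi> (inv \<alpha> x) \<le> block_index \<pi> (inv \<alpha> u)"
    using assms(6) by (intro block_index_mono[OF ordered] position_in assms) (simp add: perm_less_def)
  moreover have "block_index \<pi> (inv \<beta> u) \<le> block_index \<pi> (inv \<beta> y)"
    using assms(5) by (intro block_index_mono[OF ordered] position_in assms) (simp add: perm_le_def)
  ultimately have "block_index \<pi> (inv \<alpha> x) = block_index \<pi> (inv \<alpha> u)"
    using block_index_inv_right[OF assms(3)] assms(4) by simp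
  then show ?thesis
    using perm_less_reversed_within_block assms(1,3,6) by blast
qed

lemma separated_geodesic_step:
  assumes "x \<in> {1..n}" "y \<in> {1..n}"
    and "block_index \<pi> (inv \<alpha> x) = block_index \<pi> (inv \<beta> y)"
    and "perm_dist n \<alpha> \<beta> + perm_dist n \<beta> \<gamma> = perm_dist n \<alpha> \<gamma>"
    and "separated n \<beta> y \<gamma> z"
  shows "separated n \<alpha> x \<gamma> z"
proof -
  obtain u where separator: "u \<in> {1..n}" "perm_le \<beta> u y" "perm_le \<gamma> z u"
    using assms(5) by (auto simp: separated_def)
  show ?thesis
  proof (cases "perm_le \<alpha> u x")
    case True
    then show ?thesis
      using separator by (auto simp: separated_def)
  next
    case False
    then have less: "perm_less \<alpha> x u"
      by (simp add: perm_less_def perm_le_def)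
    have "perm_less \<beta> u x"
      by (rule perm_less_reversed_if_le_right[OF assms(1,2) separator(1) assms(3) separator(2) less])
    then have "perm_less \<gamma> u x"
      by (rule inversion_preserved_on_geodesic[OF permutes_right assms(4,1) separator(1) less])
    then have "perm_le \<gamma> z x"
      using separator(3) by (simp add: perm_less_def perm_le_def)
    then show ?thesis
      using assms(1) by (auto simp: separated_def perm_le_def)
  qed
qed

end

lemma discrete_piecewise_linear_iff:
  assumes "S \<subseteq> {\<alpha>. \<alpha> permutes {1..n}}" "F \<in> S \<rightarrow> {1..n}"
  shows "discrete_piecewise_linear n S F \<longleftrightarrow>
    (\<forall>\<alpha>\<in>S. \<forall>\<beta>\<in>S. \<forall>\<pi>. partition_adjacent n \<pi> \<alpha> \<beta> \<longrightarrow>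
      block_index \<pi> (inv \<alpha> (F \<alpha>)) = block_index \<pi> (inv \<beta> (F \<beta>)))"
proof -
  have "(\<exists>i<length \<pi>. F \<alpha> \<in> \<alpha> ` (\<pi> ! i) \<and> F \<beta> \<in> \<beta> ` (\<pi> ! i)) \<longleftrightarrow>
      block_index \<pi> (inv \<alpha> (F \<alpha>)) = block_index \<pi> (inv \<beta> (F \<beta>))"
    if "\<alpha> \<in> S" "\<beta> \<in> S" "partition_adjacent n \<pi> \<alpha> \<beta>" for \<alpha> \<beta> \<pi>
    using that assms by (intro adjacent_permutations.common_block_iff adjacent_permutations.intro) auto
  then show ?thesis
    unfolding discrete_piecewise_linear_def by blast
qed

lemma separation_imp_piecewise_linear:
  assumes "S \<subseteq> {\<alpha>. \<alpha> permutes {1..n}}" "F \<in> S \<rightarrow> {1..n}" "separation_property n S F"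
  shows "discrete_piecewise_linear n S F"
  unfolding discrete_piecewise_linear_iff[OF assms(1,2)]
proof (intro ballI allI impI)
  fix \<alpha> \<beta> \<pi> assume S: "\<alpha> \<in> S" "\<beta> \<in> S" and "partition_adjacent n \<pi> \<alpha> \<beta>"
  then interpret adjacent_permutations n \<pi> \<alpha> \<beta>
    using assms(1) by unfold_locales auto
  show "block_index \<pi> (inv \<alpha> (F \<alpha>)) = block_index \<pi> (inv \<beta> (F \<beta>))"
    using S assms(2,3) unfolding separation_property_iff_separated
    by (intro block_index_eq_if_separated) auto
qed

section \<open>Walks in the big permutograph\<close>

definition swap_partition :: "nat \<Rightarrow> nat \<Rightarrow> nat set list" where
  "swap_partition n k =
     map (\<lambda>i. {i}) [1..<k] @ [{k, Suc k}] @ map (\<lambda>i. {i}) [Suc (Suc k)..<Suc n]"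

lemma set_swap_partition:
  "set (swap_partition n k) = (\<lambda>i. {i}) ` {1..<k} \<union> {{k, Suc k}} \<union> (\<lambda>i. {i}) ` {Suc (Suc k)..n}"
  unfolding swap_partition_def by auto

lemma swap_partition_nontrivial: "swap_partition n k \<noteq> trivial_partition n"
proof
  assume "swap_partition n k = trivial_partition n"
  then have "{k, Suc k} \<in> set (trivial_partition n)"
    using set_swap_partition[of n k] by simp
  then show False
    by (auto simp: trivial_partition_def)
qed

lemma ordered_partition_swap_partition:
  assumes "k \<in> {1..<n}"
  shows "ordered_partition n (swap_partition n k)"
  unfolding ordered_partition_def
proof
  show "partition_on {1..n} (set (swap_partition n k))"
    unfolding set_swap_partition partition_on_def disjoint_def using assms by auto
  have sorted: "sorted_wrt (\<lambda>A B. \<forall>x\<in>A. \<forall>y\<in>B. x < y) (map (\<lambda>i. {i}) [a..<b])" for a b :: nat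
    by (simp add: sorted_wrt_map)
  show "sorted_wrt (\<lambda>A B. \<forall>x\<in>A. \<forall>y\<in>B. x < y) (swap_partition n k)"
    unfolding swap_partition_def sorted_wrt_append by (intro conjI sorted) auto
qed

lemma block_reversal_swap_partition:
  assumes "k \<in> {1..<n}"
  shows "block_reversal (swap_partition n k) = transpose k (Suc k)"
proof
  fix x
  note ordered = ordered_partition_swap_partition[OF assms]
  consider (outside) "x \<notin> {1..n}" | (swapped) "x \<in> {k, Suc k}"
    | (singleton) "x \<in> {1..<k} \<union> {Suc (Suc k)..n}"
    by fastforce
  then show "block_reversal (swap_partition n k) x = transpose k (Suc k) x"
  proof cases
    case outside
    then show ?thesis
      using permutes_not_in[OF block_reversal_permutes[OF ordered]] assms
      by (auto simp: transpose_def)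
  next
    case swapped
    then show ?thesis
      using block_reversal_eq[OF ordered, of "{k, Suc k}" x] by (auto simp: set_swap_partition)
  next
    case singleton
    then show ?thesis
      using block_reversal_eq[OF ordered, of "{x}" x] by (auto simp: set_swap_partition transpose_def)
  qed
qed

lemma partition_adjacent_swap_partition:
  assumes "\<alpha> permutes {1..n}" "k \<in> {1..<n}"
  shows "partition_adjacent n (swap_partition n k) \<alpha> (\<alpha> \<circ> transpose k (Suc k))"
  using ordered_partition_swap_partition[OF assms(2)] swap_partition_nontrivial
    permutes_inv_o(2)[OF assms(1)]
  by (simp add: partition_adjacent_def block_reversal_swap_partition[OF assms(2)]
      inv_comp_transpose[OF assms(1)] comp_assoc)

lemma edge_weight_pair [simp]: "edge_weight n (\<alpha>, \<beta>) = perm_dist n \<alpha> \<beta>"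
  by (simp add: edge_weight_def)

lemma verts_big_permutograph [simp]: "\<alpha> \<in> pverts (big_permutograph n) \<longleftrightarrow> \<alpha> permutes {1..n}"
  by (simp add: big_permutograph_def)

interpretation big_permutograph: pair_wf_digraph "big_permutograph n"
  by unfold_locales (auto simp: big_permutograph_def)

lemma arc_comp_transpose_Suc:
  assumes "\<alpha> permutes {1..n}" "k \<in> {1..<n}"
  shows "(\<alpha>, \<alpha> \<circ> transpose k (Suc k)) \<in> parcs (big_permutograph n)"
  using assms partition_adjacent_swap_partition[OF assms]
  by (auto simp: big_permutograph_def perm_adjacent_def intro!: permutes_compose permutes_swap_id)

lemma perm_dist_le_awalk_cost:
  assumes "big_permutograph.awalk n \<alpha> p \<beta>"
  shows "perm_dist n \<alpha> \<beta> \<le> big_permutograph.awalk_cost (edge_weight n) p"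
  using assms
proof (induction p arbitrary: \<alpha>)
  case Nil
  then show ?case
    by (simp add: big_permutograph.awalk_Nil_iff)
next
  case (Cons e p)
  then obtain \<gamma> where first_arc: "e = (\<alpha>, \<gamma>)" and rest: "big_permutograph.awalk n \<gamma> p \<beta>"
    by (cases e) (auto simp: big_permutograph.awalk_Cons_iff)
  have "\<gamma> permutes {1..n}"
    using big_permutograph.awalk_hd_in_verts[OF rest] by simp
  from perm_dist_triangle[OF this, of \<alpha> \<beta>] Cons.IH[OF rest] show ?case
    by (simp add: first_arc)
qed

lemma big_permutograph_geodesic_exists:
  assumes "\<alpha> permutes {1..n}" "\<beta> permutes {1..n}"
  shows "\<exists>p. big_permutograph.awalk n \<alpha> p \<beta> \<and>
    big_permutograph.awalk_cost (edge_weight n) p = perm_dist n \<alpha> \<beta>"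
  using assms(1)
proof (induction "perm_dist n \<alpha> \<beta>" arbitrary: \<alpha> rule: less_induct)
  case less
  show ?case
  proof (cases "\<alpha> = \<beta>")
    case True
    then show ?thesis
      using assms(2) by (intro exI[of _ "[]"]) (simp add: big_permutograph.awalk_Nil_iff)
  next
    case False
    then obtain k where inversion: "k \<in> {1..<n}" "perm_less \<beta> (\<alpha> (Suc k)) (\<alpha> k)"
      using consecutive_inversion_exists[OF less.prems assms(2)] by blast
    let ?\<alpha>' = "\<alpha> \<circ> transpose k (Suc k)"
    note dist_eq = perm_dist_comp_transpose_Suc_left[OF less.prems inversion]
    have arc: "(\<alpha>, ?\<alpha>') \<in> parcs (big_permutograph n)"
      by (rule arc_comp_transpose_Suc[OF less.prems inversion(1)])
    then have "?\<alpha>' permutes {1..n}"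
      by (simp add: big_permutograph_def)
    then obtain p where rest: "big_permutograph.awalk n ?\<alpha>' p \<beta>"
      "big_permutograph.awalk_cost (edge_weight n) p = perm_dist n ?\<alpha>' \<beta>"
      using less.hyps dist_eq by auto
    have "big_permutograph.awalk n \<alpha> ((\<alpha>, ?\<alpha>') # p) \<beta>"
      using arc rest(1) by (simp add: big_permutograph.awalk_Cons_iff)
    moreover have "big_permutograph.awalk_cost (edge_weight n) ((\<alpha>, ?\<alpha>') # p) = perm_dist n \<alpha> \<beta>"
      using rest(2) dist_eq perm_dist_comp_transpose_Suc[OF less.prems inversion(1)] by simp
    ultimately show ?thesis
      by blast
  qed
qed

lemma big_permutograph_min_cost:
  assumes "\<alpha> permutes {1..n}" "\<beta> permutes {1..n}"
  shows "big_permutograph.\<mu> n (edge_weight n) \<alpha> \<beta> = perm_dist n \<alpha> \<beta>"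
proof (rule antisym)
  show "big_permutograph.\<mu> n (edge_weight n) \<alpha> \<beta> \<le> perm_dist n \<alpha> \<beta>"
    using big_permutograph_geodesic_exists[OF assms] big_permutograph.min_cost_le_walk_cost
    by metis
  show "perm_dist n \<alpha> \<beta> \<le> big_permutograph.\<mu> n (edge_weight n) \<alpha> \<beta>"
    unfolding big_permutograph.\<mu>_def using perm_dist_le_awalk_cost by (auto intro: INF_greatest)
qed

section \<open>Walks in a permutograph\<close>

locale permutograph_on =
  fixes n :: nat and H :: "(nat \<Rightarrow> nat) pair_pre_digraph"
  assumes is_permutograph: "permutograph n H"
begin

sublocale pair_graph H
  using is_permutograph by (simp add: permutograph_def)

lemma subgraph_big_permutograph: "subgraph (with_proj H) (with_proj (big_permutograph n))"
  using is_permutograph by (simp add: permutograph_def)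

lemma vertices_permute: "pverts H \<subseteq> {\<alpha>. \<alpha> permutes {1..n}}"
  using subgraph_big_permutograph by (auto simp: subgraph_def)

lemma arc_adjacent:
  assumes "(\<alpha>, \<beta>) \<in> parcs H"
  obtains \<pi> where "adjacent_permutations n \<pi> \<alpha> \<beta>"
  using subgraph_big_permutograph assms
  by (auto simp: subgraph_def big_permutograph_def perm_adjacent_def adjacent_permutations_def)

lemma perm_dist_le_cost:
  assumes "awalk \<alpha> p \<beta>"
  shows "perm_dist n \<alpha> \<beta> \<le> awalk_cost (edge_weight n) p"
  by (intro perm_dist_le_awalk_cost subgraph_big_permutograph
      big_permutograph.subgraph_awalk_imp_awalk[OF assms])

lemma geodesic_exists:
  assumes "\<alpha> \<in> pverts H" "\<beta> \<in> pverts H"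
  obtains p where "awalk \<alpha> p \<beta>" "awalk_cost (edge_weight n) p = perm_dist n \<alpha> \<beta>"
proof -
  have dist: "\<mu> (edge_weight n) \<alpha> \<beta> = perm_dist n \<alpha> \<beta>"
    using is_permutograph assms big_permutograph_min_cost vertices_permute
    by (auto simp: permutograph_def)
  then have "\<alpha> \<rightarrow>\<^sup>*\<^bsub>with_proj H\<^esub> \<beta>"
    by (simp flip: \<mu>_reach_conv[of "edge_weight n"])
  then obtain p where "apath \<alpha> p \<beta>" "\<mu> (edge_weight n) \<alpha> \<beta> = awalk_cost (edge_weight n) p"
    using min_cost_awalk[of \<alpha> \<beta> "edge_weight n"] by (auto simp: edge_weight_def)
  then show thesis
    using that dist awalkI_apath by auto
qed

lemma separated_along_geodesic:
  assumes linear: "discrete_piecewise_linear n (pverts H) F" and F: "F \<in> pverts H \<rightarrow> {1..n}"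
    and "awalk \<alpha> p \<beta>" "awalk_cost (edge_weight n) p = perm_dist n \<alpha> \<beta>"
  shows "separated n \<alpha> (F \<alpha>) \<beta> (F \<beta>)"
  using assms(3,4)
proof (induction p arbitrary: \<alpha>)
  case Nil
  then show ?case
    using F by (auto simp: awalk_Nil_iff separated_def perm_le_def)
next
  case (Cons e p)
  then obtain \<gamma> where first_arc: "e = (\<alpha>, \<gamma>)" "(\<alpha>, \<gamma>) \<in> parcs H" and rest: "awalk \<gamma> p \<beta>"
    by (cases e) (auto simp: awalk_Cons_iff)
  have verts: "\<alpha> \<in> pverts H" "\<gamma> \<in> pverts H"
    using first_arc(2) wellformed' by blast+
  obtain \<pi> where "adjacent_permutations n \<pi> \<alpha> \<gamma>"
    using arc_adjacent[OF first_arc(2)] .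
  then interpret adjacent_permutations n \<pi> \<alpha> \<gamma> .
  have "perm_dist n \<alpha> \<gamma> + awalk_cost (edge_weight n) p = perm_dist n \<alpha> \<beta>"
    using Cons.prems(2) by (simp add: first_arc(1))
  then have geodesic: "perm_dist n \<alpha> \<gamma> + perm_dist n \<gamma> \<beta> = perm_dist n \<alpha> \<beta>"
    and "awalk_cost (edge_weight n) p = perm_dist n \<gamma> \<beta>"
    using perm_dist_le_cost[OF rest] perm_dist_triangle[OF permutes_right, of \<alpha> \<beta>] by linarith+
  then have "separated n \<gamma> (F \<gamma>) \<beta> (F \<beta>)"
    using Cons.IH[OF rest] by simp
  moreover have "block_index \<pi> (inv \<alpha> (F \<alpha>)) = block_index \<pi> (inv \<gamma> (F \<gamma>))"
    using linear verts adjacent unfolding discrete_piecewise_linear_iff[OF vertices_permute F] by blast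
  ultimately show ?case
    using F verts by (intro separated_geodesic_step[OF _ _ _ geodesic]) auto
qed

lemma piecewise_linear_imp_separation:
  assumes "discrete_piecewise_linear n (pverts H) F" "F \<in> pverts H \<rightarrow> {1..n}"
  shows "separation_property n (pverts H) F"
  unfolding separation_property_iff_separated
proof (intro ballI)
  fix \<alpha> \<beta> assume "\<alpha> \<in> pverts H" "\<beta> \<in> pverts H"
  then obtain p where "awalk \<alpha> p \<beta>" "awalk_cost (edge_weight n) p = perm_dist n \<alpha> \<beta>"
    by (rule geodesic_exists)
  then show "separated n \<alpha> (F \<alpha>) \<beta> (F \<beta>)"
    by (rule separated_along_geodesic[OF assms])
qed

end

section \<open>Polynomials over finite total orders\<close>

lemma (in partial_order) inf_eq_if_least:
  assumes "least L m A"
  shows "\<Sqinter>A = m"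
proof -
  have "is_glb L m A"
    using assms by (intro greatest_LowerI) (auto simp: least_def Lower_def)
  then show ?thesis
    unfolding inf_def by (blast intro: greatest_unique)
qed

lemma (in partial_order) sup_eq_if_greatest: "greatest L m A \<Longrightarrow> \<Squnion>A = m"
  using partial_order.inf_eq_if_least[OF dual_order] by simp

lemma (in total_order) dual_total_order: "total_order (inv_gorder L)"
  by (intro partial_order.total_orderI[OF dual_order]) (simp add: total)

lemma (in total_order) least_inf:
  assumes "finite A" "A \<noteq> {}" "A \<subseteq> carrier L"
  shows "least L (\<Sqinter>A) A"
proof -
  have "\<exists>m. least L m A"
    using assms
  proof (induction A rule: finite_ne_induct)
    case (singleton x)
    then show ?case
      by (auto simp: least_def)
  next
    case (insert x A)
    then obtain m where "least L m A" "m \<in> carrier L"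
      by auto
    then have "least L (if x \<sqsubseteq> m then x else m) (insert x A)"
      using insert.prems total[of x m] by (auto simp: least_def intro: le_trans)
    then show ?case ..
  qed
  then show ?thesis
    using inf_eq_if_least by blast
qed

lemma (in total_order) greatest_sup:
  assumes "finite A" "A \<noteq> {}" "A \<subseteq> carrier L"
  shows "greatest L (\<Squnion>A) A"
  using total_order.least_inf[OF dual_total_order] assms by simp

locale finite_total_orders =
  fixes S :: "'i set" and X :: "'a set" and L :: "'i \<Rightarrow> 'a gorder"
  assumes total_orders: "i \<in> S \<Longrightarrow> total_order (L i)"
    and carrier_eq: "i \<in> S \<Longrightarrow> carrier (L i) = X"
    and finite_carrier: "finite X"
    and carrier_nonempty: "X \<noteq> {}"
begin

lemma inf_least: "i \<in> S \<Longrightarrow> K \<subseteq> X \<Longrightarrow> K \<noteq> {} \<Longrightarrow> least (L i) (\<Sqinter>\<^bsub>L i\<^esub> K) K"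
  using carrier_eq finite_subset[OF _ finite_carrier]
  by (intro total_order.least_inf[OF total_orders]) auto

lemma sup_greatest: "i \<in> S \<Longrightarrow> K \<subseteq> X \<Longrightarrow> K \<noteq> {} \<Longrightarrow> greatest (L i) (\<Squnion>\<^bsub>L i\<^esub> K) K"
  using carrier_eq finite_subset[OF _ finite_carrier]
  by (intro total_order.greatest_sup[OF total_orders]) auto

definition upset :: "'i \<Rightarrow> 'a \<Rightarrow> 'a set" where
  "upset i x = {u \<in> X. x \<sqsubseteq>\<^bsub>L i\<^esub> u}"

lemma least_upset:
  assumes "i \<in> S" "x \<in> X"
  shows "least (L i) x (upset i x)"
proof -
  interpret total_order "L i"
    by (rule total_orders[OF assms(1)])
  show ?thesis
    using assms carrier_eq by (auto simp: least_def upset_def)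
qed

lemma upset_nonempty:
  assumes "i \<in> S" "x \<in> X"
  shows "upset i x \<noteq> {}"
  using least_mem[OF least_upset[OF assms]] by blast

lemma upset_subset: "upset i x \<subseteq> X"
  by (auto simp: upset_def)

lemma inf_upset_le:
  assumes "i \<in> S" "j \<in> S" "x \<in> X" "y \<in> X"
    and "u \<in> X" "u \<sqsubseteq>\<^bsub>L i\<^esub> x" "y \<sqsubseteq>\<^bsub>L j\<^esub> u"
  shows "\<Sqinter>\<^bsub>L i\<^esub> upset j y \<sqsubseteq>\<^bsub>L i\<^esub> x"
proof -
  interpret total_order "L i"
    by (rule total_orders[OF assms(1)])
  note inf = inf_least[OF assms(1) upset_subset upset_nonempty[OF assms(2,4)]]
  have "u \<in> upset j y"
    using assms by (simp add: upset_def)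
  then have "\<Sqinter>\<^bsub>L i\<^esub> upset j y \<sqsubseteq>\<^bsub>L i\<^esub> u"
    by (rule least_le[OF inf])
  then show ?thesis
    by (rule le_trans[OF _ assms(6)]) (use assms least_closed[OF inf] carrier_eq in simp_all)
qed

lemma eq_sup_inf_upsets:
  assumes F: "F \<in> S \<rightarrow> X"
    and separation: "\<forall>i\<in>S. \<forall>j\<in>S. \<exists>u\<in>X. u \<sqsubseteq>\<^bsub>L i\<^esub> F i \<and> F j \<sqsubseteq>\<^bsub>L j\<^esub> u"
    and i: "i \<in> S"
  shows "F i = (SSUP\<^bsub>L i\<^esub> K:(\<lambda>j. upset j (F j)) ` S. \<Sqinter>\<^bsub>L i\<^esub> K)"
proof -
  interpret total_order "L i"
    by (rule total_orders[OF i])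
  have "F i = \<Sqinter>\<^bsub>L i\<^esub> upset i (F i)"
    using least_upset i F by (intro inf_eq_if_least[symmetric]) auto
  then have "F i \<in> (\<lambda>K. \<Sqinter>\<^bsub>L i\<^esub> K) ` (\<lambda>j. upset j (F j)) ` S"
    using i by blast
  moreover have "\<Sqinter>\<^bsub>L i\<^esub> upset j (F j) \<in> carrier (L i)" if "j \<in> S" for j
    using that F by (intro least_closed[OF inf_least[OF i upset_subset upset_nonempty]]) auto
  moreover have "\<Sqinter>\<^bsub>L i\<^esub> upset j (F j) \<sqsubseteq>\<^bsub>L i\<^esub> F i" if "j \<in> S" for j
  proof -
    obtain u where "u \<in> X" "u \<sqsubseteq>\<^bsub>L i\<^esub> F i" "F j \<sqsubseteq>\<^bsub>L j\<^esub> u"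
      using separation i \<open>j \<in> S\<close> by blast
    then show ?thesis
      using i \<open>j \<in> S\<close> F by (intro inf_upset_le) auto
  qed
  ultimately have "greatest (L i) (F i) ((\<lambda>K. \<Sqinter>\<^bsub>L i\<^esub> K) ` (\<lambda>j. upset j (F j)) ` S)"
    by (auto simp: greatest_def)
  then show ?thesis
    by (simp add: supr_def sup_eq_if_greatest)
qed

lemma separation_imp_polynomial:
  assumes F: "F \<in> S \<rightarrow> X"
    and separation: "\<forall>i\<in>S. \<forall>j\<in>S. \<exists>u\<in>X. u \<sqsubseteq>\<^bsub>L i\<^esub> F i \<and> F j \<sqsubseteq>\<^bsub>L j\<^esub> u"
  shows "\<exists>\<K>. \<K> \<noteq> {} \<and> (\<forall>K\<in>\<K>. K \<noteq> {} \<and> K \<subseteq> X) \<and>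
    (\<forall>i\<in>S. F i = (SSUP\<^bsub>L i\<^esub> K:\<K>. \<Sqinter>\<^bsub>L i\<^esub> K))"
proof (cases "S = {}")
  case True
  then show ?thesis
    using carrier_nonempty by (intro exI[of _ "{X}"]) simp
next
  case False
  let ?\<K> = "(\<lambda>j. upset j (F j)) ` S"
  have "?\<K> \<noteq> {}"
    using False by simp
  moreover have "\<forall>K\<in>?\<K>. K \<noteq> {} \<and> K \<subseteq> X"
    using upset_subset upset_nonempty[OF _ funcset_mem[OF F]] by blast
  moreover have "\<forall>i\<in>S. F i = (SSUP\<^bsub>L i\<^esub> K:?\<K>. \<Sqinter>\<^bsub>L i\<^esub> K)"
    by (intro ballI eq_sup_inf_upsets[OF F separation])
  ultimately show ?thesis
    by (intro exI[of _ ?\<K>] conjI)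
qed

lemma polynomial_imp_separation:
  assumes \<K>: "\<K> \<noteq> {}" "\<And>K. K \<in> \<K> \<Longrightarrow> K \<noteq> {} \<and> K \<subseteq> X"
    and F: "\<And>i. i \<in> S \<Longrightarrow> F i = (SSUP\<^bsub>L i\<^esub> K:\<K>. \<Sqinter>\<^bsub>L i\<^esub> K)"
    and indices: "i \<in> S" "j \<in> S"
  shows "\<exists>u\<in>X. u \<sqsubseteq>\<^bsub>L i\<^esub> F i \<and> F j \<sqsubseteq>\<^bsub>L j\<^esub> u"
proof -
  have inf: "least (L k) (\<Sqinter>\<^bsub>L k\<^esub> K) K" if "k \<in> S" "K \<in> \<K>" for k K
    using inf_least[OF that(1)] \<K>(2)[OF that(2)] by blast
  have F_greatest: "greatest (L k) (F k) ((\<lambda>K. \<Sqinter>\<^bsub>L k\<^esub> K) ` \<K>)" if "k \<in> S" for k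
  proof -
    have "(\<lambda>K. \<Sqinter>\<^bsub>L k\<^esub> K) ` \<K> \<subseteq> X"
      using least_mem[OF inf[OF that]] \<K>(2) by blast
    then show ?thesis
      using sup_greatest[OF that] \<K>(1) F[OF that] by (simp add: supr_def)
  qed
  obtain K where attained: "K \<in> \<K>" "F j = \<Sqinter>\<^bsub>L j\<^esub> K"
    using greatest_mem[OF F_greatest[OF indices(2)]] by blast
  have inf_mem: "(\<Sqinter>\<^bsub>L i\<^esub> K) \<in> K"
    by (rule least_mem[OF inf[OF indices(1) attained(1)]])
  moreover have "(\<Sqinter>\<^bsub>L i\<^esub> K) \<sqsubseteq>\<^bsub>L i\<^esub> F i"
    using greatest_le[OF F_greatest[OF indices(1)]] attained(1) by blast
  moreover have "F j \<sqsubseteq>\<^bsub>L j\<^esub> (\<Sqinter>\<^bsub>L i\<^esub> K)"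
    unfolding attained(2) by (rule least_le[OF inf[OF indices(2) attained(1)] inf_mem])
  ultimately show ?thesis
    using \<K>(2)[OF attained(1)] by blast
qed

end

lemma carrier_perm_order [simp]: "carrier (perm_order n \<alpha>) = {1..n}"
  by (simp add: perm_order_def)

lemma le_perm_order [simp]: "x \<sqsubseteq>\<^bsub>perm_order n \<alpha>\<^esub> y \<longleftrightarrow> perm_le \<alpha> x y"
  by (simp add: perm_order_def)

lemma total_order_perm_order:
  assumes "\<alpha> permutes {1..n}"
  shows "total_order (perm_order n \<alpha>)"
  by unfold_locales
    (auto simp: perm_order_def perm_le_def dest: injD[OF permutes_inj[OF permutes_inv[OF assms]]])

lemma separation_property_iff_polynomial_on:
  assumes "n \<ge> 1" "S \<subseteq> {\<alpha>. \<alpha> permutes {1..n}}" "F \<in> S \<rightarrow> {1..n}"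
  shows "separation_property n S F \<longleftrightarrow> polynomial_on n S F"
proof -
  interpret finite_total_orders S "{1..n}" "perm_order n"
    using assms(1,2) by (intro finite_total_orders.intro total_order_perm_order) auto
  have meet: "(IINF\<^bsub>perm_order n \<alpha>\<^esub> j:K. const_fn j \<alpha>) = \<Sqinter>\<^bsub>perm_order n \<alpha>\<^esub> K" for \<alpha> K
    by (simp add: infi_def const_fn_def)
  show ?thesis
  proof
    assume "separation_property n S F"
    then show "polynomial_on n S F"
      using separation_imp_polynomial[OF assms(3)]
      by (simp add: separation_property_def polynomial_on_def meet)
  next
    assume "polynomial_on n S F"
    then obtain \<K> where "\<K> \<noteq> {}" "\<And>K. K \<in> \<K> \<Longrightarrow> K \<noteq> {} \<and> K \<subseteq> {1..n}"
      and "\<And>\<alpha>. \<alpha> \<in> S \<Longrightarrow> F \<alpha> = (SSUP\<^bsub>perm_order n \<alpha>\<^esub> K:\<K>. \<Sqinter>\<^bsub>perm_order n \<alpha>\<^esub> K)"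
      unfolding polynomial_on_def meet by blast
    from polynomial_imp_separation[OF this] show "separation_property n S F"
      by (simp add: separation_property_def)
  qed
qed

theorem theorem3:
  fixes n :: nat
    and H :: "(nat \<Rightarrow> nat) pair_pre_digraph"
    and F :: "(nat \<Rightarrow> nat) \<Rightarrow> nat"
  assumes "n \<ge> 1"
    and "permutograph n H"
    and "F \<in> pverts H \<rightarrow> {1..n}"
  shows "(discrete_piecewise_linear n (pverts H) F \<longleftrightarrow> separation_property n (pverts H) F) \<and>
         (separation_property n (pverts H) F \<longleftrightarrow> polynomial_on n (pverts H) F)"
proof -
  interpret permutograph_on n H
    by unfold_locales (rule assms(2))
  show ?thesis
    using piecewise_linear_imp_separation[OF _ assms(3)]
      separation_imp_piecewise_linear[OF vertices_permute assms(3)]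
      separation_property_iff_polynomial_on[OF assms(1) vertices_permute assms(3)] by blast
qed

end
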